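(* Let $G$ be a connected noncomplete graph with $5 \leq n \leq 8$ vertices. If $G$ is isomorphic to neither $G_1$ nor $G_2$ and $\delta(G) \geq 2$, then $pc(G)=2$.
   Context: All graphs are finite, simple and undirected; $\delta(G)$ is the minimum degree. In an edge-colored graph, a path is a proper path if no two adjacent (consecutive) edges of the path receive the same color. For a connected graph $G$, the proper connection number $pc(G)$ is the minimum number of colors in an edge-coloring of $G$ (adjacent edges may share colors) such that every pair of distinct vertices of $G$ is joined by at least one proper path. $G_1$ is the graph on 7 vertices consisting of three triangles sharing exactly one common vertex (a vertex $v$ together with three disjoint edges $u_1u_2$, $u_3u_4$, $u_5u_6$, with $v$ adjacent to all of $u_1,\dots,u_6$). $G_2$ is the graph on 8 vertices with vertex set $\{v,u_1,u_2,w_1,w_2,w_3,w_4,w_5\}$ and edge set $\{vu_1, vu_2, u_1u_2, vw_1, w_1w_2, w_1w_5, w_2w_5, w_1w_3, w_1w_4, w_3w_4\}$. *)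

theory Defs
  imports Main
begin

definition simple_graph :: "'a set \<Rightarrow> 'a set set \<Rightarrow> bool" where
  "simple_graph V E \<longleftrightarrow> finite V \<and> (\<forall>e\<in>E. e \<subseteq> V \<and> card e = 2)"

definition complete_graph :: "'a set \<Rightarrow> 'a set set \<Rightarrow> bool" where
  "complete_graph V E \<longleftrightarrow> (\<forall>u\<in>V. \<forall>v\<in>V. u \<noteq> v \<longrightarrow> {u, v} \<in> E)"

definition degree :: "'a set set \<Rightarrow> 'a \<Rightarrow> nat" where
  "degree E v = card {e \<in> E. v \<in> e}"

definition min_degree :: "'a set \<Rightarrow> 'a set set \<Rightarrow> nat" where
  "min_degree V E = Min (degree E ` V)"

text \<open>A path is given by its list of pairwise distinct vertices.\<close>

definition path_edges :: "'a list \<Rightarrow> 'a set list" where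
  "path_edges p = map (\<lambda>(x, y). {x, y}) (zip p (tl p))"

definition is_path :: "'a set \<Rightarrow> 'a set set \<Rightarrow> 'a \<Rightarrow> 'a list \<Rightarrow> 'a \<Rightarrow> bool" where
  "is_path V E u p v \<longleftrightarrow>
     p \<noteq> [] \<and> hd p = u \<and> last p = v \<and> distinct p \<and> set p \<subseteq> V \<and> set (path_edges p) \<subseteq> E"

definition connected_graph :: "'a set \<Rightarrow> 'a set set \<Rightarrow> bool" where
  "connected_graph V E \<longleftrightarrow> V \<noteq> {} \<and> (\<forall>u\<in>V. \<forall>v\<in>V. \<exists>p. is_path V E u p v)"

definition proper_path :: "('a set \<Rightarrow> nat) \<Rightarrow> 'a list \<Rightarrow> bool" where
  "proper_path c p \<longleftrightarrow>
     (\<forall>i. Suc i < length (path_edges p) \<longrightarrow> c (path_edges p ! i) \<noteq> c (path_edges p ! Suc i))"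

definition proper_connected :: "'a set \<Rightarrow> 'a set set \<Rightarrow> ('a set \<Rightarrow> nat) \<Rightarrow> bool" where
  "proper_connected V E c \<longleftrightarrow>
     (\<forall>u\<in>V. \<forall>v\<in>V. u \<noteq> v \<longrightarrow> (\<exists>p. is_path V E u p v \<and> proper_path c p))"

text \<open>
  Only the values of \<open>c\<close> on \<open>E\<close> matter: \<open>card (c ` E)\<close> is the number of colors in use. If the graph
  is connected, a \<open>c\<close> injective on \<open>E\<close> shows that the minimum is over a nonempty set of numbers.
\<close>

definition proper_connection_number :: "'a set \<Rightarrow> 'a set set \<Rightarrow> nat" where
  "proper_connection_number V E =
     (LEAST k. \<exists>c :: 'a set \<Rightarrow> nat. card (c ` E) = k \<and> proper_connected V E c)"

definition isomorphic_graphs ::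
    "'a set \<Rightarrow> 'a set set \<Rightarrow> 'b set \<Rightarrow> 'b set set \<Rightarrow> bool" where
  "isomorphic_graphs V E V' E' \<longleftrightarrow>
     (\<exists>f. bij_betw f V V' \<and> (\<forall>u\<in>V. \<forall>v\<in>V. {u, v} \<in> E \<longleftrightarrow> {f u, f v} \<in> E'))"

text \<open>In \<open>G1\<close>, the common vertex \<open>v\<close> is \<open>0\<close>, and \<open>u\<^sub>i\<close> is \<open>i\<close>.\<close>

definition G1_verts :: "nat set" where
  "G1_verts = {0..6}"

definition G1_edges :: "nat set set" where
  "G1_edges = {{0, 1}, {0, 2}, {0, 3}, {0, 4}, {0, 5}, {0, 6}, {1, 2}, {3, 4}, {5, 6}}"

text \<open>In \<open>G2\<close>, \<open>v\<close> is \<open>0\<close>, \<open>u\<^sub>1, u\<^sub>2\<close> are \<open>1, 2\<close>, and \<open>w\<^sub>i\<close> is \<open>i + 2\<close>.\<close>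

definition G2_verts :: "nat set" where
  "G2_verts = {0..7}"

definition G2_edges :: "nat set set" where
  "G2_edges = {{0, 1}, {0, 2}, {1, 2}, {0, 3}, {3, 4}, {3, 7}, {4, 7}, {3, 5}, {3, 6}, {5, 6}}"

end

theory Submission
  imports Defs
begin

text \<open>
  Every connected graph of minimum degree at least 2 is spanned by a subgraph that grows from a
  cycle: as long as a vertex set \<open>S\<close> is not everything, a longest path that starts with an edge
  leaving \<open>S\<close> and then stays outside \<open>S\<close> ends in a vertex with a second neighbour in \<open>S\<close> or on the
  path itself. Adding edges cannot destroy proper paths, so it is enough to follow this growth up to
  passing to spanning subgraphs. On at most 8 vertices this leaves the few graphs of the
  \<open>catalogue\<close> below; that it is closed under the growth step is checked by computation. Apart from
  \<open>G1\<close> and \<open>G2\<close>, each catalogue graph with at least 5 vertices has an explicit 2-coloring, and adding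
  any edge to \<open>G1\<close> or \<open>G2\<close> gives a graph that is spanned by one of the others. One color does not
  suffice for a noncomplete graph.
\<close>

section \<open>Paths and colorings\<close>

lemma path_edges_Cons: "path_edges (x # y # p) = {x, y} # path_edges (y # p)"
  by (simp add: path_edges_def)

lemma length_path_edges: "length (path_edges p) = length p - 1"
  by (simp add: path_edges_def)

lemma path_edges_nth: "Suc i < length p \<Longrightarrow> path_edges p ! i = {p ! i, p ! Suc i}"
  by (simp add: path_edges_def nth_tl)

lemma path_edges_take: "path_edges (take k p) = take (k - 1) (path_edges p)"
  by (rule nth_equalityI) (auto simp: length_path_edges path_edges_nth less_diff_conv)

lemma path_edges_drop: "path_edges (drop k p) = drop k (path_edges p)"
  by (rule nth_equalityI) (auto simp: length_path_edges path_edges_nth)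

lemma path_edges_rev: "path_edges (rev p) = rev (path_edges p)"
  by (rule nth_equalityI)
    (auto simp: length_path_edges path_edges_nth rev_nth insert_commute Suc_diff_Suc)

lemma path_edges_map: "path_edges (map f p) = map (\<lambda>(x, y). {f x, f y}) (zip p (tl p))"
  by (simp add: path_edges_def map_tl[symmetric] zip_map1 zip_map2 case_prod_unfold)

lemma path_edges_subset_iff:
  "set (path_edges p) \<subseteq> E \<longleftrightarrow> successively (\<lambda>x y. {x, y} \<in> E) p"
  by (induction p rule: induct_list012) (auto simp: path_edges_Cons, simp_all add: path_edges_def)

lemma proper_path_iff: "proper_path c p \<longleftrightarrow> successively (\<lambda>e f. c e \<noteq> c f) (path_edges p)"
  by (auto simp: proper_path_def successively_conv_nth)

text \<open>Lets a coloring be certified by a few long paths: the stretch between two vertices of a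
  proper path is proper, and so is its reversal, which serves the case that \<open>v\<close> comes
  before \<open>u\<close>.\<close>

lemma proper_subpath:
  assumes "distinct p" "set p \<subseteq> V" "set (path_edges p) \<subseteq> E" "proper_path c p"
    and "u \<in> set p" "v \<in> set p"
  shows "\<exists>q. is_path V E u q v \<and> proper_path c q"
proof -
  have forward: "\<exists>q. is_path V E (p ! i) q (p ! j) \<and> proper_path c q"
    if p: "distinct p" "set p \<subseteq> V" "set (path_edges p) \<subseteq> E" "proper_path c p"
      and ij: "i \<le> j" "j < length p" for p i j
  proof (intro exI conjI)
    let ?q = "take (Suc (j - i)) (drop i p)"
    have "length ?q = Suc (j - i)"
      using ij by simp
    then have "?q \<noteq> []" "hd ?q = p ! i" "last ?q = p ! j" "distinct ?q"
      using ij p(1) by (auto simp: hd_drop_conv_nth last_conv_nth simp del: length_take)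
    moreover have "set ?q \<subseteq> V"
      using p(2) by (meson in_set_dropD in_set_takeD subset_iff)
    moreover have edges: "path_edges ?q = take (j - i) (drop i (path_edges p))"
      by (simp add: path_edges_take path_edges_drop)
    moreover have "set (path_edges ?q) \<subseteq> E"
      using p(3) unfolding edges by (meson in_set_dropD in_set_takeD subset_iff)
    ultimately show "is_path V E (p ! i) ?q (p ! j)"
      by (simp add: is_path_def)
    show "proper_path c ?q"
      using p(4) ij by (auto simp: proper_path_def edges)
  qed
  obtain i j where ij: "i < length p" "p ! i = u" "j < length p" "p ! j = v"
    using assms(5,6) by (auto simp: in_set_conv_nth)
  show ?thesis
  proof (cases "i \<le> j")
    case True
    then show ?thesis using forward[of p i j] assms ij by simp
  next
    case False
    have "proper_path c (rev p)"
      using assms(4) by (auto simp: proper_path_iff path_edges_rev eq_commute)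
    moreover have "rev p ! (length p - Suc i) = u" "rev p ! (length p - Suc j) = v"
      using ij by (auto simp: rev_nth)
    ultimately show ?thesis
      using forward[of "rev p" "length p - Suc i" "length p - Suc j"] assms ij False
      by (simp add: path_edges_rev)
  qed
qed

text \<open>A path joining two nonadjacent vertices has two consecutive edges, and these differ in
  color if the path is proper.\<close>

lemma two_colors_needed:
  assumes "finite E" "\<not> complete_graph V E" "proper_connected V E c"
  shows "2 \<le> card (c ` E)"
proof (rule ccontr)
  assume "\<not> 2 \<le> card (c ` E)"
  then have "card (c ` E) \<le> Suc 0"
    by simp
  then have "\<forall>x\<in>c ` E. \<forall>y\<in>c ` E. x = y"
    using assms(1) by (metis card_le_Suc0_iff_eq finite_imageI)
  then have mono: "c e = c f" if "e \<in> E" "f \<in> E" for e f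
    using that by blast
  obtain u v where uv: "u \<in> V" "v \<in> V" "u \<noteq> v" "{u, v} \<notin> E"
    using assms(2) by (auto simp: complete_graph_def)
  then obtain p where p: "is_path V E u p v" "proper_path c p"
    using assms(3) by (auto simp: proper_connected_def)
  consider "length p \<le> 1" | "length p = 2" | "Suc 0 < length (path_edges p)"
    by (simp add: length_path_edges) linarith
  then show False
  proof cases
    case 1
    then show False
      using p(1) uv(3) by (cases p) (auto simp: is_path_def)
  next
    case 2
    then obtain x y where "p = [x, y]"
      by (auto simp: numeral_2_eq_2 length_Suc_conv)
    then show False
      using p(1) uv(4) by (auto simp: is_path_def path_edges_def)
  next
    case 3
    have "path_edges p ! i \<in> E" if "i < length (path_edges p)" for i
      using p(1) nth_mem[OF that] by (auto simp: is_path_def)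
    then have "path_edges p ! 0 \<in> E" "path_edges p ! Suc 0 \<in> E"
      using 3 by (meson Suc_lessD)+
    then show False
      using p(2) 3 mono unfolding proper_path_def by blast
  qed
qed

section \<open>Graphs as lists of earlier neighbours\<close>

text \<open>
  Entry \<open>i\<close> of a \<open>graph\<close> lists the neighbours of the vertex \<open>i\<close> that are smaller than \<open>i\<close>.
\<close>

type_synonym graph = "nat list list"

definition adj :: "graph \<Rightarrow> nat \<Rightarrow> nat \<Rightarrow> bool" where
  "adj T x y \<longleftrightarrow> y \<in> set (T ! x) \<or> x \<in> set (T ! y)"

lemma adj_sym: "adj T x y \<longleftrightarrow> adj T y x"
  by (auto simp: adj_def)

definition wf_graph :: "graph \<Rightarrow> bool" where
  "wf_graph T \<longleftrightarrow> (\<forall>i\<in>set [0..<length T]. \<forall>j\<in>set (T ! i). j < i)"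

text \<open>Vertex \<open>i\<close> is realised by \<open>xs ! i\<close>. The copy need not be
  induced: \<open>E\<close> may contain further edges among the vertices of
  \<open>xs\<close>.\<close>

definition copy :: "'a set set \<Rightarrow> graph \<Rightarrow> 'a list \<Rightarrow> bool" where
  "copy E T xs \<longleftrightarrow> wf_graph T \<and> length xs = length T \<and> distinct xs \<and>
     (\<forall>i<length T. \<forall>j\<in>set (T ! i). {xs ! i, xs ! j} \<in> E)"

lemma copy_adj:
  assumes "copy E T xs" "adj T x y" "x < length T" "y < length T"
  shows "{xs ! x, xs ! y} \<in> E"
  using assms by (auto simp: copy_def adj_def insert_commute)

text \<open>
  Attaches to vertex \<open>a\<close> a path of \<open>m\<close> new vertices and joins the last of them to \<open>b\<close>, where \<open>b\<close> may
  itself lie on the new path.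
\<close>

definition extend :: "graph \<Rightarrow> nat \<times> nat \<times> nat \<Rightarrow> graph" where
  "extend T = (\<lambda>(m, a, b). T @ map (\<lambda>i.
     (if i = 0 then a else length T + i - 1) # (if i = m - 1 then [b] else [])) [0..<m])"

text \<open>
  The ways to reach at most 8 vertices without a double edge; \<open>a \<le> b\<close> loses nothing, since a path
  between two old vertices can be reversed.
\<close>

definition extensions :: "nat \<Rightarrow> (nat \<times> nat \<times> nat) list" where
  "extensions n = [(m, a, b). m \<leftarrow> [1..<9 - n], a \<leftarrow> [0..<n],
     b \<leftarrow> (if m = 1 then [a + 1..<n] else [a..<n + m - 2])]"

text \<open>For \<open>m > 1\<close> the last new vertex is \<open>n + m - 1\<close> and its
  predecessor is \<open>n + m - 2\<close>; keeping \<open>b\<close> below both avoids loops and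
  double edges, while \<open>a = b\<close> closes a cycle at \<open>a\<close>. For
  \<open>m = 1\<close> the predecessor is \<open>a\<close> itself.\<close>

lemma in_extensions_iff:
  "(m, a, b) \<in> set (extensions n) \<longleftrightarrow> 1 \<le> m \<and> m < 9 - n \<and> a < n \<and>
     (if m = 1 then a < b \<and> b < n else a \<le> b \<and> b < n + m - 2)"
  by (auto simp: extensions_def image_iff split: if_splits)

lemma copy_extend:
  assumes T: "copy E T xs" and dist: "distinct (xs @ p)" and p: "p \<noteq> []"
    and a: "a < length T" and b: "b < length T + length p - 1"
    and walk: "successively (\<lambda>x y. {x, y} \<in> E) (xs ! a # p)"
    and close: "{last p, (xs @ p) ! b} \<in> E"
  shows "copy E (extend T (length p, a, b)) (xs @ p)"
proof -
  let ?n = "length T" and ?m = "length p"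
  have n: "length xs = ?n" using T by (simp add: copy_def)
  have len: "length (extend T (?m, a, b)) = ?n + ?m"
    by (simp add: extend_def)
  have entry: "\<forall>j\<in>set (extend T (?m, a, b) ! i). j < i \<and> {(xs @ p) ! i, (xs @ p) ! j} \<in> E"
    if i: "i < ?n + ?m" for i
  proof (cases "i < ?n")
    case True
    then have "extend T (?m, a, b) ! i = T ! i"
      by (simp add: extend_def nth_append)
    moreover have "\<forall>j\<in>set (T ! i). j < i \<and> {xs ! i, xs ! j} \<in> E"
      using T True by (auto simp: copy_def wf_graph_def)
    ultimately show ?thesis
      using True n by (fastforce simp: nth_append)
  next
    case False
    define k where "k = i - ?n"
    have k: "i = ?n + k" "k < ?m" using False i by (auto simp: k_def)
    have new: "extend T (?m, a, b) ! i =
        (if k = 0 then a else ?n + k - 1) # (if k = ?m - 1 then [b] else [])"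
      using k by (simp add: extend_def nth_append)
    \<comment> \<open>Prefixing \<open>xs ! a\<close> shifts the path by one, so entry
      \<open>k\<close> is the predecessor of \<open>p ! k\<close>.\<close>
    have step: "{(xs ! a # p) ! k, p ! k} \<in> E"
      using walk k by (auto simp: successively_conv_nth)
    have "(xs @ p) ! (if k = 0 then a else ?n + k - 1) = (xs ! a # p) ! k"
      using a n k by (auto simp: nth_append nth_Cons' not_less)
    moreover have "(xs @ p) ! i = p ! k"
      using n k by (simp add: nth_append)
    moreover have "p ! k = last p" if "k = ?m - 1"
      using that p by (simp add: last_conv_nth)
    ultimately show ?thesis
      using new step close a b k p by (auto simp: insert_commute)
  qed
  show ?thesis
    using entry dist n len by (auto simp: copy_def wf_graph_def)
qed

section \<open>Searching for spanning subgraphs\<close>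

definition neighbours :: "graph \<Rightarrow> nat list list" where
  "neighbours T = map (\<lambda>x. filter (adj T x) [0..<length T]) [0..<length T]"

text \<open>Prunes the search: a vertex with an earlier neighbour \<open>j\<close> can only go to a
  neighbour of the image of \<open>j\<close>.\<close>

fun candidates :: "nat list list \<Rightarrow> graph \<Rightarrow> nat list \<Rightarrow> nat list" where
  "candidates A ((j # js) # Bs) h = A ! (h ! j)"
| "candidates A Bs h = [0..<length A]"

text \<open>
  The conditionals here and below make the simplifier evaluate lazily, which connectives do not.
\<close>

definition admissible :: "nat list list \<Rightarrow> nat list \<Rightarrow> nat list \<Rightarrow> nat \<Rightarrow> bool" where
  "admissible A B h v \<longleftrightarrow>
     (if v \<in> set h then False else v < length A \<and> (\<forall>j\<in>set B. v \<in> set (A ! (h ! j))))"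

text \<open>
  Backtracking: \<open>h\<close> lists the images of the vertices embedded so far, \<open>Bs\<close> the entries of the
  remaining ones, and \<open>vs\<close> the images still to be tried for the first of these.
\<close>

fun search :: "nat list list \<Rightarrow> graph \<Rightarrow> nat list \<Rightarrow> nat list \<Rightarrow> bool" where
  "search A [] vs h = True"
| "search A (B # Bs) [] h = False"
| "search A (B # Bs) (v # vs) h =
    (if (if admissible A B h v then search A Bs (candidates A Bs (h @ [v])) (h @ [v]) else False)
     then True else search A (B # Bs) vs h)"

fun some_embeds :: "graph list \<Rightarrow> nat list list \<Rightarrow> bool" where
  "some_embeds [] A = False"
| "some_embeds (T # Ts) A = (if search A T [0..<length A] [] then True else some_embeds Ts A)"

text \<open>Injectivity and all adjacencies come from \<open>admissible\<close>, so nothing has to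
  be known about \<open>vs\<close> or \<open>candidates\<close>. The entries in \<open>Bs\<close>
  belong to the vertices from \<open>length h\<close> on, hence the shifted indices.\<close>

lemma search_sound:
  assumes "search A Bs vs h" "distinct h" "set h \<subseteq> {..<length A}"
    and "\<forall>i<length Bs. \<forall>j\<in>set (Bs ! i). j < length h + i"
  shows "\<exists>h'. distinct (h @ h') \<and> set h' \<subseteq> {..<length A} \<and> length h' = length Bs \<and>
    (\<forall>i<length Bs. \<forall>j\<in>set (Bs ! i). (h @ h') ! (length h + i) \<in> set (A ! ((h @ h') ! j)))"
  using assms
proof (induction A Bs vs h rule: search.induct)
  case (1 A vs h)
  then show ?case by auto
next
  case (2 A B Bs h)
  then show ?case by simp
next
  case (3 A B Bs v vs h)
  show ?case
  proof (cases "admissible A B h v \<and> search A Bs (candidates A Bs (h @ [v])) (h @ [v])")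
    case True
    then have v: "v \<notin> set h" "v < length A" "\<forall>j\<in>set B. v \<in> set (A ! (h ! j))"
      by (auto simp: admissible_def split: if_splits)
    have B: "\<forall>j\<in>set B. j < length h"
      using "3.prems"(4) by force
    have "\<exists>h'. distinct ((h @ [v]) @ h') \<and> set h' \<subseteq> {..<length A} \<and> length h' = length Bs \<and>
      (\<forall>i<length Bs. \<forall>j\<in>set (Bs ! i).
        ((h @ [v]) @ h') ! (length (h @ [v]) + i) \<in> set (A ! (((h @ [v]) @ h') ! j)))"
    proof (rule "3.IH"(1))
      show "\<forall>i<length Bs. \<forall>j\<in>set (Bs ! i). j < length (h @ [v]) + i"
        using "3.prems"(4) by fastforce
    qed (use True v "3.prems" in auto)
    then obtain h' where h': "distinct (h @ v # h')" "set h' \<subseteq> {..<length A}"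
      "length h' = length Bs"
      "\<And>i j. i < length Bs \<Longrightarrow> j \<in> set (Bs ! i) \<Longrightarrow>
        (h @ v # h') ! Suc (length h + i) \<in> set (A ! ((h @ v # h') ! j))"
      by auto
    have "\<forall>i<length (B # Bs). \<forall>j\<in>set ((B # Bs) ! i).
        (h @ v # h') ! (length h + i) \<in> set (A ! ((h @ v # h') ! j))"
    proof (intro allI impI ballI)
      fix i j assume "i < length (B # Bs)" "j \<in> set ((B # Bs) ! i)"
      then show "(h @ v # h') ! (length h + i) \<in> set (A ! ((h @ v # h') ! j))"
        using v B h'(4) by (cases i) (auto simp: nth_append)
    qed
    then show ?thesis
      using h' v(2) by (intro exI[of _ "v # h'"]) auto
  next
    case False
    then show ?thesis
      using "3.IH"(2) "3.prems" by (auto split: if_splits)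
  qed
qed

lemma some_embeds_sound:
  assumes "some_embeds Ts (neighbours S)" "copy E S xs"
    and "\<forall>T\<in>set Ts. wf_graph T \<and> length T = length S"
  shows "\<exists>T\<in>set Ts. \<exists>ys. copy E T ys \<and> set ys = set xs"
proof -
  define A where "A = neighbours S"
  have A: "length A = length S" by (simp add: A_def neighbours_def)
  have n: "length xs = length S" "distinct xs" using assms(2) by (auto simp: copy_def)
  have "\<exists>T\<in>set Ts. search A T [0..<length A] []"
    using assms(1) unfolding A_def[symmetric]
    by (induction Ts) (auto split: if_splits)
  then obtain T where T: "T \<in> set Ts" "search A T [0..<length A] []" by blast
  then have wf: "wf_graph T" "length T = length S" using assms(3) by auto
  obtain h where h: "distinct h" "set h \<subseteq> {..<length A}" "length h = length T"
    "\<And>i j. i < length T \<Longrightarrow> j \<in> set (T ! i) \<Longrightarrow> h ! i \<in> set (A ! (h ! j))"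
    using search_sound[OF T(2)] wf(1) by (auto simp: wf_graph_def)
  \<comment> \<open>Equal numbers of vertices make the embedding onto, so the copy of
    \<open>T\<close> uses exactly the vertices of \<open>xs\<close>.\<close>
  have "set h = {..<length A}"
    using h(1,2,3) wf(2) A by (intro card_subset_eq) (auto simp: distinct_card)
  then have "set (map ((!) xs) h) = set xs"
    using A n nth_image[of "length xs" xs] by (simp add: lessThan_atLeast0)
  moreover have "copy E T (map ((!) xs) h)"
    unfolding copy_def
  proof (intro conjI allI impI ballI)
    show "distinct (map ((!) xs) h)"
      using h(1,2) n A by (auto simp: distinct_map inj_on_def nth_eq_iff_index_eq subset_iff)
    fix i j assume ij: "i < length T" "j \<in> set (T ! i)"
    then have j: "j < length T" using wf(1) by (force simp: wf_graph_def)
    have lt: "h ! i < length S" "h ! j < length S"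
      using h(2,3) A ij(1) j by (metis lessThan_iff nth_mem subsetD)+
    then have "adj S (h ! j) (h ! i)"
      using h(4)[OF ij] by (simp add: A_def neighbours_def)
    then show "{map ((!) xs) h ! i, map ((!) xs) h ! j} \<in> E"
      using copy_adj[OF assms(2), of "h ! i" "h ! j"] lt ij(1) j h(3) by (simp add: adj_sym)
  qed (use wf h(3) in auto)
  ultimately show ?thesis using T(1) by blast
qed

section \<open>The catalogue\<close>

text \<open>
  The tables come from a computer search. Together with \<open>G1\<close>, \<open>G2\<close> and the cycles of length 3 and 4,
  these are the edge-minimal connected graphs of minimum degree at least 2, except that on 8 vertices
  the first entry, a path, stands for all those with a Hamiltonian path.
\<close>

definition pc2_graphs :: "nat \<Rightarrow> graph list" where
  "pc2_graphs n =
  (if n = 5 then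
   [[[], [0], [1], [2], [3, 0]],
    [[], [0], [1, 0], [1], [3, 1]],
    [[], [0], [0], [2, 1], [3, 0]]]
  else if n = 6 then
   [[[], [0], [1, 0], [0], [0], [4, 3]],
    [[], [0], [1], [2], [3], [4, 0]],
    [[], [0], [1], [2, 0], [0], [4, 2]],
    [[], [0], [1, 0], [1], [3], [4, 3]],
    [[], [0], [1], [2, 0], [2, 0], [2, 0]]]
  else if n = 7 then
   [[[], [0], [1, 0], [0], [0], [4], [5, 3]],
    [[], [0], [1, 0], [0], [3], [3], [5, 4]],
    [[], [0], [1], [2, 0], [2], [4], [5, 0]],
    [[], [0], [1], [2], [3], [4], [5, 0]],
    [[], [0], [1, 0], [1], [1], [4, 3], [5, 1]],
    [[], [0], [1, 0], [0], [3], [4], [5, 4]],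
    [[], [0], [1], [2, 0], [2], [4], [5, 2]],
    [[], [0], [0], [2], [3, 1], [3], [5, 0]],
    [[], [0], [1], [2, 0], [2, 0], [2, 0], [2, 0]],
    [[], [0], [1], [2, 0], [2, 0], [2], [5, 0]]]
  else if n = 8 then
   [[[], [0], [1], [2], [3], [4], [5], [0]],
    [[], [0], [1, 0], [1], [3, 1], [1], [1], [6, 5]],
    [[], [0], [1, 0], [0], [3], [4, 0], [4, 0], [4, 0]],
    [[], [0], [1, 0], [0], [3], [4, 0], [4], [6, 0]],
    [[], [0], [1, 0], [0], [3], [3], [5, 4], [6, 3]],
    [[], [0], [1], [2, 0], [2, 0], [2], [5], [6, 0]],
    [[], [0], [1], [2, 0], [2, 0], [2], [5], [6, 2]],
    [[], [0], [1, 0], [1], [3], [4, 1], [4], [6, 4]],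
    [[], [0], [1], [2, 0], [2], [4], [5, 0], [5, 0]],
    [[], [0], [0], [2, 1], [1], [4, 2], [2, 1], [2, 1]],
    [[], [0], [1], [2, 0], [2, 0], [2, 0], [2, 0], [2, 0]],
    [[], [0], [1], [2, 0], [2], [4, 0], [2], [6, 0]]]
  else [])"

definition G1_graph :: graph where
  "G1_graph = [[], [0], [1, 0], [0], [3, 0], [0], [5, 0]]"

definition G2_graph :: graph where
  "G2_graph = [[], [0], [1, 0], [0], [3], [3], [5, 3], [4, 3]]"

definition catalogue :: "nat \<Rightarrow> graph list" where
  "catalogue n = pc2_graphs n @
    (if n = 3 then [[[], [0], [1, 0]]] else if n = 4 then [[[], [0], [1], [2, 0]]]
     else if n = 7 then [G1_graph] else if n = 8 then [G2_graph] else [])"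

lemma catalogue_wf:
  assumes "T \<in> set (catalogue n)"
  shows "wf_graph T" "length T = n" "3 \<le> n" "n \<le> 8"
proof -
  have "\<forall>n\<in>set [3..<9]. \<forall>T\<in>set (catalogue n). wf_graph T \<and> length T = n"
    by code_simp
  \<comment> \<open>For every other \<open>n\<close> the catalogue is empty.\<close>
  moreover have "n \<in> set [3..<9]"
  proof (rule ccontr)
    assume "n \<notin> set [3..<9]"
    then have "n \<noteq> 3" "n \<noteq> 4" "n \<noteq> 5" "n \<noteq> 6" "n \<noteq> 7" "n \<noteq> 8"
      by auto
    then show False
      using assms by (simp add: catalogue_def pc2_graphs_def)
  qed
  ultimately show "wf_graph T" "length T = n" "3 \<le> n" "n \<le> 8"
    using assms by auto
qed

text \<open>\<open>[[]]\<close> is a single vertex, and a path of \<open>m\<close> new vertices from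
  it back to it is the cycle of length \<open>m + 1\<close>.\<close>

lemma catalogue_cycle:
  "\<forall>m\<in>set [2..<8]. some_embeds (catalogue (m + 1)) (neighbours (extend [[]] (m, 0, 0)))"
  by code_simp

lemma catalogue_extend_3:
  "\<forall>T\<in>set (catalogue 3). \<forall>e\<in>set (extensions 3).
     some_embeds (catalogue (3 + fst e)) (neighbours (extend T e))"
  by code_simp

lemma catalogue_extend_4:
  "\<forall>T\<in>set (catalogue 4). \<forall>e\<in>set (extensions 4).
     some_embeds (catalogue (4 + fst e)) (neighbours (extend T e))"
  by code_simp

lemma catalogue_extend_5:
  "\<forall>T\<in>set (catalogue 5). \<forall>e\<in>set (extensions 5).
     some_embeds (catalogue (5 + fst e)) (neighbours (extend T e))"
  by code_simp

lemma catalogue_extend_6: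
  "\<forall>T\<in>set (catalogue 6). \<forall>e\<in>set (extensions 6).
     some_embeds (catalogue (6 + fst e)) (neighbours (extend T e))"
  by code_simp

lemma catalogue_extend_7:
  "\<forall>T\<in>set (catalogue 7). \<forall>e\<in>set (extensions 7).
     some_embeds (catalogue (7 + fst e)) (neighbours (extend T e))"
  by code_simp

text \<open>Collects the checks for 3 to 7 vertices; a graph on 8 vertices has no
  extensions.\<close>

lemma catalogue_extend:
  assumes "T \<in> set (catalogue n)" "e \<in> set (extensions n)"
  shows "some_embeds (catalogue (n + fst e)) (neighbours (extend T e))"
proof -
  obtain m a b where "e = (m, a, b)" by (cases e)
  then have "n < 8"
    using assms(2) by (auto simp: in_extensions_iff)
  then consider "n = 3" | "n = 4" | "n = 5" | "n = 6" | "n = 7"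
    using catalogue_wf(3)[OF assms(1)] by linarith
  then show ?thesis
  proof cases
    case 1
    then show ?thesis using assms catalogue_extend_3 by blast
  next
    case 2
    then show ?thesis using assms catalogue_extend_4 by blast
  next
    case 3
    then show ?thesis using assms catalogue_extend_5 by blast
  next
    case 4
    then show ?thesis using assms catalogue_extend_6 by blast
  next
    case 5
    then show ?thesis using assms catalogue_extend_7 by blast
  qed
qed

text \<open>Listing \<open>x\<close> in the entry of \<open>y > x\<close> adds the edge
  \<open>xy\<close>. The target \<open>pc2_graphs 7\<close> excludes \<open>G1_graph\<close>, so a
  single extra edge already yields a colorable spanning subgraph.\<close>

lemma G1_add_edge:
  "\<forall>y\<in>set [0..<7]. \<forall>x\<in>set [0..<y]. if x \<in> set (G1_graph ! y) then True
     else some_embeds (pc2_graphs 7) (neighbours (G1_graph[y := x # G1_graph ! y]))"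
  by code_simp

lemma G2_add_edge:
  "\<forall>y\<in>set [0..<8]. \<forall>x\<in>set [0..<y]. if x \<in> set (G2_graph ! y) then True
     else some_embeds (pc2_graphs 8) (neighbours (G2_graph[y := x # G2_graph ! y]))"
  by code_simp

section \<open>Colorings of the catalogue graphs\<close>

text \<open>
  In \<open>(R, ps)\<close>, the subgraph \<open>R\<close> consists of the edges of the first color, and \<open>ps\<close> are proper paths
  such that any two vertices lie on one of them.
\<close>

definition proper_coloring :: "graph \<Rightarrow> graph \<times> nat list list \<Rightarrow> bool" where
  "proper_coloring T = (\<lambda>(R, ps).
     (\<forall>p\<in>set ps. distinct p \<and> (\<forall>x\<in>set p. x < length T) \<and> successively (adj T) p \<and>
        successively (\<lambda>(x, y) (x', y'). adj R x y \<noteq> adj R x' y') (zip p (tl p))) \<and>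
     (\<forall>x\<in>set [0..<length T]. \<forall>y\<in>set [0..<x]. \<exists>p\<in>set ps. x \<in> set p \<and> y \<in> set p))"

text \<open>Aligned entry by entry with \<open>pc2_graphs n\<close>. A single listed path is a
  Hamiltonian path with alternating colors.\<close>

definition pc2_colorings :: "nat \<Rightarrow> (graph \<times> nat list list) list" where
  "pc2_colorings n =
  (if n = 5 then
   [([[], [0], [], [2], []],
     [[0, 1, 2, 3, 4]]),
    ([[], [], [0], [1], []],
     [[0, 2, 1, 3, 4]]),
    ([[], [0], [], [2], []],
     [[1, 0, 2, 3, 4]])]
  else if n = 6 then
   [([[], [0], [], [], [], [4]],
     [[2, 1, 0, 4, 5, 3]]),
    ([[], [0], [], [2], [], []],
     [[4, 3, 2, 1, 0, 5]]),
    ([[], [], [1], [], [0], []],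
     [[3, 2, 1, 0, 4, 5]]),
    ([[], [0], [], [], [3], []],
     [[2, 0, 1, 3, 4, 5]]),
    ([[], [0], [], [], [2, 0], [2]],
     [[1, 0, 5, 2, 3], [1, 2, 5, 0, 4], [3, 2, 4]])]
  else if n = 7 then
   [([[], [], [1], [0], [], [], [5]],
     [[1, 2, 0, 3, 6, 5, 4]]),
    ([[], [], [1], [0], [], [], [5]],
     [[1, 2, 0, 3, 5, 6, 4]]),
    ([[], [0], [], [2], [], [4], []],
     [[1, 0, 3, 2, 4, 5, 6]]),
    ([[], [0], [], [2], [], [4], []],
     [[0, 1, 2, 3, 4, 5, 6]]),
    ([[], [0], [], [1], [], [], [5]],
     [[2, 0, 1, 6, 5, 4], [2, 0, 1, 6, 5, 3], [3, 1, 4]]),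
    ([[], [], [1], [0], [], [4], []],
     [[1, 2, 0, 3, 4, 5, 6]]),
    ([[], [0], [], [2], [], [4], []],
     [[1, 0, 3, 2, 4, 5, 6]]),
    ([[], [], [0], [], [1], [3], []],
     [[2, 0, 1, 4, 3, 5, 6]]),
    ([[], [0], [], [0], [2], [2], []],
     [[1, 0, 4, 2, 3], [1, 0, 5, 2, 6], [3, 0, 4, 2, 6], [4, 2, 3, 0, 5]]),
    ([[], [], [1], [2, 0], [0], [2], [5]],
     [[1, 2, 4, 0, 6, 5], [3, 2, 4, 0, 6, 5], [1, 0, 3]])]
  else if n = 8 then
   [([[], [0], [], [2], [], [4], [], []],
     [[6, 5, 4, 3, 2, 1, 0, 7]]),
    ([[], [], [0], [1], [], [1], [], [6]],
     [[0, 2, 1, 5, 7, 6], [4, 3, 1, 6, 7, 5], [0, 2, 1, 3, 4]]),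
    ([[], [0], [], [0], [], [4], [4], []],
     [[2, 1, 0, 5, 4, 3], [2, 1, 0, 6, 4, 7], [3, 0, 5, 4, 7], [5, 4, 3, 0, 6]]),
    ([[], [0], [], [], [3], [4, 0], [], [6]],
     [[2, 1, 0, 3, 4, 6, 7], [2, 1, 0, 7, 6, 4, 5], [3, 0, 5]]),
    ([[], [], [1], [0], [3], [], [], [6]],
     [[1, 2, 0, 3, 7, 6, 5], [1, 2, 0, 3, 7, 6, 4], [4, 3, 5]]),
    ([[], [], [1], [2, 0], [0], [], [], [6]],
     [[1, 2, 4, 0, 7, 6, 5], [3, 2, 4, 0, 7, 6, 5], [1, 0, 3]]),
    ([[], [0], [1], [2], [], [2], [], [6]],
     [[1, 0, 3, 2, 7, 6, 5], [1, 0, 3, 2, 4], [4, 2, 5, 6, 7]]),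
    ([[], [], [0], [1], [], [4], [4], []],
     [[0, 2, 1, 3, 4, 6, 7], [0, 2, 1, 3, 4, 5], [5, 1, 3, 4, 6, 7]]),
    ([[], [0], [], [2], [2], [4], [0], []],
     [[1, 2, 3, 0, 6, 5, 4], [3, 2, 1, 0, 7], [4, 5, 6, 0, 7]]),
    ([[], [0], [], [2], [1], [2], [], []],
     [[0, 2, 3, 1, 4, 5], [6, 2, 5, 4, 1, 7], [0, 1, 3, 2, 6], [0, 1, 3, 2, 7]]),
    ([[], [0], [], [0], [2], [2], [2], []],
     [[1, 0, 4, 2, 3], [1, 0, 5, 2, 7], [3, 0, 6, 2, 7], [4, 2, 1, 0, 6], [4, 2, 3, 0, 5],
      [0, 4, 2, 7], [5, 2, 1, 0, 6]]),
    ([[], [0], [], [2], [], [4, 0], [2], []],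
     [[1, 0, 3, 2, 4, 5], [3, 0, 1, 2, 6, 7], [5, 4, 2, 6, 7]])]
  else [])"

lemma pc2_graphs_coloring:
  assumes "T \<in> set (pc2_graphs n)"
  shows "\<exists>C. proper_coloring T C"
proof -
  have "\<forall>n\<in>set [5..<9]. list_all2 proper_coloring (pc2_graphs n) (pc2_colorings n)"
    by code_simp
  moreover have "n \<in> set [5..<9]"
  proof (rule ccontr)
    assume "n \<notin> set [5..<9]"
    then have "n \<noteq> 5" "n \<noteq> 6" "n \<noteq> 7" "n \<noteq> 8"
      by auto
    then show False
      using assms by (simp add: pc2_graphs_def)
  qed
  ultimately have "list_all2 proper_coloring (pc2_graphs n) (pc2_colorings n)"
    by blast
  then show ?thesis
    using assms by (metis in_set_conv_nth list_all2_conv_all_nth)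
qed

lemma proper_coloring_copy:
  assumes C: "proper_coloring T (R, ps)" and T: "copy E T xs"
  shows "\<exists>c :: 'a set \<Rightarrow> nat. c ` E \<subseteq> {0, 1} \<and> proper_connected (set xs) E c"
proof -
  let ?n = "length T"
  have xs: "length xs = ?n" "distinct xs" using T by (auto simp: copy_def)
  \<comment> \<open>Edges of \<open>E\<close> outside the copy get color 1 by default; this is
    harmless, since the listed paths use only edges of the copy.\<close>
  define c :: "'a set \<Rightarrow> nat" where
    "c e = (if \<exists>x<?n. \<exists>y<?n. adj R x y \<and> e = {xs ! x, xs ! y} then 0 else 1)" for e
  have c: "c {xs ! x, xs ! y} = (if adj R x y then 0 else 1)" if "x < ?n" "y < ?n" for x y
    using that xs unfolding c_def
    by (auto simp: doubleton_eq_iff nth_eq_iff_index_eq adj_sym)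
  have path: "\<exists>q. is_path (set xs) E u q v \<and> proper_path c q"
    if p: "p \<in> set ps" "x \<in> set p" "y \<in> set p" and uv: "u = xs ! x" "v = xs ! y" for p x y u v
  proof -
    let ?p = "map ((!) xs) p"
    have p': "distinct p" "\<And>x. x \<in> set p \<Longrightarrow> x < ?n" "successively (adj T) p"
      "successively (\<lambda>(x, y) (x', y'). adj R x y \<noteq> adj R x' y') (zip p (tl p))"
      using C p(1) by (auto simp: proper_coloring_def)
    have dist: "distinct ?p"
      using p'(1,2) xs by (auto simp: distinct_map inj_on_def nth_eq_iff_index_eq)
    have sub: "set ?p \<subseteq> set xs"
      using p'(2) xs by auto
    have "successively (\<lambda>x y. {xs ! x, xs ! y} \<in> E) p"
      using p'(3) by (rule successively_mono) (use copy_adj[OF T] p'(2) in auto)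
    then have edges: "set (path_edges ?p) \<subseteq> E"
      by (simp add: path_edges_subset_iff successively_map)
    have color: "c (case e of (x, y) \<Rightarrow> {xs ! x, xs ! y}) =
        (if case e of (x, y) \<Rightarrow> adj R x y then 0 else 1)" if "e \<in> set (zip p (tl p))" for e
    proof -
      obtain x y where e: "e = (x, y)" by (cases e)
      with that have "x \<in> set p" "y \<in> set (tl p)"
        by (auto dest: set_zip_leftD set_zip_rightD)
      moreover from this have "y \<in> set p" by (cases p) auto
      ultimately show ?thesis using c p'(2) e by simp
    qed
    have "successively (\<lambda>e f. c (case e of (x, y) \<Rightarrow> {xs ! x, xs ! y}) \<noteq>
        c (case f of (x, y) \<Rightarrow> {xs ! x, xs ! y})) (zip p (tl p))"
      using p'(4) by (rule successively_mono) (simp add: color split: prod.splits)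
    then have proper: "proper_path c ?p"
      by (simp add: proper_path_iff path_edges_map successively_map)
    have "u \<in> set ?p" "v \<in> set ?p"
      using p uv by auto
    then show ?thesis
      by (rule proper_subpath[OF dist sub edges proper])
  qed
  have "proper_connected (set xs) E c"
    unfolding proper_connected_def
  proof (intro ballI impI)
    fix u v assume "u \<in> set xs" "v \<in> set xs" "u \<noteq> v"
    then obtain x y where xy: "x < ?n" "y < ?n" "u = xs ! x" "v = xs ! y" "x \<noteq> y"
      using xs by (metis in_set_conv_nth)
    have "\<exists>p\<in>set ps. i \<in> set p \<and> j \<in> set p" if "j < i" "i < ?n" for i j
      using C that by (simp add: proper_coloring_def)
    then have "\<exists>p\<in>set ps. x \<in> set p \<and> y \<in> set p"
      using xy(1,2,5) by (metis linorder_neqE_nat)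
    then show "\<exists>p. is_path (set xs) E u p v \<and> proper_path c p"
      using path xy(3,4) by blast
  qed
  moreover have "c ` E \<subseteq> {0, 1}" by (auto simp: c_def)
  ultimately show ?thesis by blast
qed

section \<open>Growing a spanning subgraph\<close>

lemma crossing_edge:
  assumes "successively (\<lambda>x y. {x, y} \<in> E) p" "p \<noteq> []" "hd p \<in> S" "last p \<notin> S"
  shows "\<exists>x y. x \<in> S \<and> y \<in> set p - S \<and> {x, y} \<in> E"
  using assms by (induction p rule: induct_list012) (auto split: if_splits)

text \<open>At least two edges contain \<open>v\<close>, and at most one of them is
  \<open>{v, u}\<close>.\<close>

lemma second_neighbour:
  assumes "simple_graph V E" "min_degree V E \<ge> 2" "v \<in> V"
  shows "\<exists>b\<in>V. {v, b} \<in> E \<and> b \<noteq> v \<and> b \<noteq> u"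
proof -
  have "finite V" using assms(1) by (simp add: simple_graph_def)
  then have "2 \<le> degree E v"
    using assms(2,3) unfolding min_degree_def by (meson Min_le finite_imageI imageI order_trans)
  then have "\<not> {e \<in> E. v \<in> e} \<subseteq> {{v, u}}"
    using card_mono[of "{{v, u}}" "{e \<in> E. v \<in> e}"] by (auto simp: degree_def)
  then obtain e where e: "e \<in> E" "v \<in> e" "e \<noteq> {v, u}" by auto
  then have "card e = 2" "e \<subseteq> V" using assms(1) by (auto simp: simple_graph_def)
  then obtain b where "e = {v, b}" "b \<noteq> v" using e(2) by (auto simp: card_2_iff)
  then show ?thesis using e \<open>e \<subseteq> V\<close> by auto
qed

text \<open>\<open>last (a # butlast p)\<close> is the vertex before \<open>last p\<close> on the
  walk, which is \<open>a\<close> if \<open>p\<close> has only one vertex.\<close>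

lemma exists_ear:
  assumes G: "simple_graph V E" "connected_graph V E" "min_degree V E \<ge> 2"
    and S: "S \<subseteq> V" "S \<noteq> {}" "S \<noteq> V"
  obtains a p b where "a \<in> S" "p \<noteq> []" "distinct p" "set p \<subseteq> V - S"
    "successively (\<lambda>x y. {x, y} \<in> E) (a # p)" "{last p, b} \<in> E" "b \<in> S \<union> set p" "b \<noteq> last p"
    "b \<noteq> last (a # butlast p)"
proof -
  define P where "P p \<longleftrightarrow> p \<noteq> [] \<and> distinct p \<and> set p \<subseteq> V - S \<and>
    (\<exists>a\<in>S. successively (\<lambda>x y. {x, y} \<in> E) (a # p))" for p
  obtain s t where st: "s \<in> S" "t \<in> V - S" using S by auto
  then obtain q where q: "is_path V E s q t"
    using G(2) S(1) unfolding connected_graph_def by blast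
  then obtain x y where "x \<in> S" "y \<in> set q - S" "{x, y} \<in> E"
    using crossing_edge[of E q S] st by (auto simp: is_path_def path_edges_subset_iff)
  then have start: "P [y]"
    using q by (auto simp: P_def is_path_def)
  have fin: "finite V" using G(1) by (simp add: simple_graph_def)
  have "length p \<le> card V" if "P p" for p
    using that fin by (metis P_def card_mono distinct_card Diff_subset subset_trans)
  then obtain p where p: "P p" and longest: "\<And>q. P q \<Longrightarrow> length q \<le> length p"
    using ex_has_greatest_nat[of P "[y]" length "Suc (card V)"] start by (auto simp: less_Suc_eq_le)
  then obtain a where a: "a \<in> S" "successively (\<lambda>x y. {x, y} \<in> E) (a # p)"
    by (auto simp: P_def)
  have p': "p \<noteq> []" "distinct p" "set p \<subseteq> V - S" using p by (auto simp: P_def)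
  then have "last p \<in> V" by (meson Diff_subset last_in_set subsetD)
  then obtain b where b: "b \<in> V" "{last p, b} \<in> E" "b \<noteq> last p" "b \<noteq> last (a # butlast p)"
    using second_neighbour[OF G(1,3)] by blast
  \<comment> \<open>Otherwise \<open>b\<close> would prolong the longest path
    \<open>p\<close>.\<close>
  have "b \<in> S \<union> set p"
  proof (rule ccontr)
    assume "b \<notin> S \<union> set p"
    then have "P (p @ [b])"
      using p' a b by (auto simp: P_def successively_append_iff successively_Cons
        intro!: bexI[of _ a])
    then show False using longest by fastforce
  qed
  then show thesis using that a p' b by blast
qed

text \<open>Translates an ear into a triple: \<open>i\<close> and \<open>j\<close> are the positions
  of \<open>a\<close> and \<open>b\<close> in \<open>xs @ p\<close>, and the two inequalities for
  \<open>b\<close> become the bounds in \<open>extensions\<close>.\<close>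

lemma extension_of_ear:
  assumes T: "copy E T xs" and "p \<noteq> []" "distinct p" "set p \<inter> set xs = {}"
    and n: "length T + length p \<le> 8"
    and a: "a \<in> set xs" and walk: "successively (\<lambda>x y. {x, y} \<in> E) (a # p)"
    and b: "{last p, b} \<in> E" "b \<in> set xs \<union> set p" "b \<noteq> last p" "b \<noteq> last (a # butlast p)"
  shows "\<exists>e\<in>set (extensions (length T)). \<exists>ys. fst e = length p \<and>
    copy E (extend T e) ys \<and> set ys = set xs \<union> set p"
proof -
  let ?n = "length T" and ?m = "length p"
  have xs: "length xs = ?n" "distinct xs" using T by (auto simp: copy_def)
  obtain i where i: "i < ?n" "xs ! i = a" using a xs by (metis in_set_conv_nth)
  obtain j where j: "j < ?n + ?m" "(xs @ p) ! j = b"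
    using b(2) xs by (metis in_set_conv_nth length_append set_append)
  have "last p = (xs @ p) ! (?n + ?m - 1)"
    using assms(2) xs last_conv_nth[of "xs @ p"] by simp
  then have "j \<noteq> ?n + ?m - 1"
    using b(3) j(2) by auto
  moreover have "j \<noteq> ?n + ?m - 2" if "?m \<noteq> 1"
  proof
    assume "j = ?n + ?m - 2"
    moreover have "?m \<ge> 2" using that assms(2) by (cases p) (auto simp: Suc_le_eq)
    ultimately have "b = last (butlast p)" "butlast p \<noteq> []"
      using j xs by (auto simp: nth_append last_conv_nth nth_butlast numeral_2_eq_2
        length_greater_0_conv[symmetric] simp del: length_greater_0_conv)
    then show False using b(4) by simp
  qed
  moreover have "j \<noteq> i" if "?m = 1"
    using b(4) i j xs that by (auto simp: nth_append length_Suc_conv)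
  ultimately have j': "j < ?n + ?m - 1" "?m = 1 \<Longrightarrow> j \<noteq> i" "?m \<noteq> 1 \<Longrightarrow> j < ?n + ?m - 2"
    using j(1) by linarith+
  have m: "1 \<le> ?m" "?m < 9 - ?n"
    using assms(2) n by (cases p; simp)+
  show ?thesis
  proof (cases "i \<le> j")
    case True
    have "copy E (extend T (?m, i, j)) (xs @ p)"
      using T assms(2-4) i j j'(1) walk b(1) xs by (intro copy_extend) auto
    moreover have "(?m, i, j) \<in> set (extensions ?n)"
      using True i(1) j' m by (auto simp: in_extensions_iff)
    ultimately show ?thesis
      by (intro bexI[of _ "(?m, i, j)"] exI[of _ "xs @ p"]) auto
  next
    case False
    \<comment> \<open>Here \<open>j < i\<close>, so \<open>b\<close> is an old vertex and the ear
      can be run backwards from \<open>b\<close> to \<open>a\<close>.\<close>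
    then have bx: "xs ! j = b" "j < ?n" using i j xs by (auto simp: nth_append)
    have rev_walk: "successively (\<lambda>x y. {x, y} \<in> E) (rev p)"
      using walk by (auto simp: successively_Cons insert_commute)
    have "copy E (extend T (length (rev p), j, i)) (xs @ rev p)"
    proof (rule copy_extend[OF T])
      show "successively (\<lambda>x y. {x, y} \<in> E) (xs ! j # rev p)"
        using rev_walk b(1) bx assms(2) by (auto simp: successively_Cons hd_rev insert_commute)
      show "{last (rev p), (xs @ rev p) ! i} \<in> E"
        using walk i xs assms(2) by (auto simp: successively_Cons last_rev nth_append insert_commute)
    qed (use assms(2-4) bx False i xs m in auto)
    moreover have "(?m, j, i) \<in> set (extensions ?n)"
      using False i(1) bx(2) m by (auto simp: in_extensions_iff)
    ultimately show ?thesis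
      by (intro bexI[of _ "(?m, j, i)"] exI[of _ "xs @ rev p"]) auto
  qed
qed

text \<open>The start of the growth: an ear of a single vertex contains a cycle.\<close>

lemma exists_catalogue_copy:
  assumes G: "simple_graph V E" "connected_graph V E" "min_degree V E \<ge> 2"
    and V: "2 \<le> card V" "card V \<le> 8"
  shows "\<exists>xs. set xs \<subseteq> V \<and> (\<exists>T\<in>set (catalogue (length xs)). copy E T xs)"
proof -
  obtain v where v: "v \<in> V" using G(2) by (auto simp: connected_graph_def)
  have fin: "finite V" using G(1) by (simp add: simple_graph_def)
  have S: "{v} \<subseteq> V" "{v} \<noteq> {}" "{v} \<noteq> V"
    using v V(1) by auto
  obtain a p b where ear: "a \<in> {v}" "p \<noteq> []" "distinct p" "set p \<subseteq> V - {v}"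
    "successively (\<lambda>x y. {x, y} \<in> E) (a # p)" "{last p, b} \<in> E" "b \<in> {v} \<union> set p" "b \<noteq> last p"
    "b \<noteq> last (a # butlast p)"
    by (rule exists_ear[OF G S])
  define q where "q = v # p"
  have q: "distinct q" "set q \<subseteq> V" "successively (\<lambda>x y. {x, y} \<in> E) q" "last q = last p"
    using ear v by (auto simp: q_def)
  have "b \<in> set q"
    using ear(7) by (auto simp: q_def)
  then obtain j where j: "j < length q" "q ! j = b"
    by (metis in_set_conv_nth)
  \<comment> \<open>The ear may close at an inner vertex \<open>b\<close>; dropping everything
    before \<open>b\<close> leaves the cycle \<open>b # r\<close>.\<close>
  define r where "r = drop (Suc j) q"
  have drop_q: "drop j q = b # r"
    using Cons_nth_drop_Suc[OF j(1)] j(2) by (simp add: r_def)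
  have "j \<noteq> length q - 1"
    using j ear(2,8) by (auto simp: q_def last_conv_nth nth_Cons')
  moreover have "last (a # butlast p) = q ! (length q - 2)"
    using ear(1,2) by (cases p rule: rev_cases) (auto simp: q_def last_conv_nth nth_Cons' nth_append)
  then have "j \<noteq> length q - 2"
    using ear(9) j(2) by auto
  \<comment> \<open>\<open>b\<close> is neither the last vertex of \<open>q\<close> nor the one
    before it, so the cycle has length at least 3.\<close>
  ultimately have len: "length r \<ge> 2"
    using j(1) by (simp add: r_def)
  have r: "distinct (b # r)" "set (b # r) \<subseteq> V" "successively (\<lambda>x y. {x, y} \<in> E) (b # r)"
    "last r = last p"
  proof -
    have "q = take j q @ b # r" by (simp flip: drop_q)
    with q(1-3) show "distinct (b # r)" "set (b # r) \<subseteq> V"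
      "successively (\<lambda>x y. {x, y} \<in> E) (b # r)"
      by (metis distinct_append, metis set_append le_sup_iff, metis successively_append_iff)
    show "last r = last p"
      using len q(4) by (auto simp: r_def)
  qed
  have cycle: "copy E (extend [[]] (length r, 0, 0)) ([b] @ r)"
    by (rule copy_extend) (use r len ear(6) in \<open>auto simp: copy_def wf_graph_def\<close>)
  have "length r \<in> set [2..<8]"
    using len card_mono[OF fin r(2)] distinct_card[OF r(1)] V(2) by auto
  then have "some_embeds (catalogue (length r + 1)) (neighbours (extend [[]] (length r, 0, 0)))"
    using catalogue_cycle by blast
  moreover have "length (extend [[]] (length r, 0, 0)) = length r + 1"
    by (simp add: extend_def)
  ultimately obtain T ys where T: "T \<in> set (catalogue (length r + 1))" "copy E T ys"
    "set ys = set ([b] @ r)"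
    using some_embeds_sound[OF _ cycle, of "catalogue (length r + 1)"] catalogue_wf(1,2) by metis
  moreover have "length ys = length r + 1"
    using catalogue_wf(2)[OF T(1)] T(2) by (simp add: copy_def)
  ultimately show ?thesis
    using r(2) by (intro exI[of _ ys]) auto
qed

text \<open>A catalogue copy with the most vertices must be spanning, since an ear would lead to a
  larger one.\<close>

lemma spanning_catalogue_copy:
  assumes G: "simple_graph V E" "connected_graph V E" "min_degree V E \<ge> 2"
    and V: "2 \<le> card V" "card V \<le> 8"
  shows "\<exists>xs. set xs = V \<and> (\<exists>T\<in>set (catalogue (card V)). copy E T xs)"
proof -
  define P where "P xs \<longleftrightarrow> set xs \<subseteq> V \<and> (\<exists>T\<in>set (catalogue (length xs)). copy E T xs)" for xs
  have fin: "finite V" using G(1) by (simp add: simple_graph_def)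
  have bound: "length xs \<le> card V" if "P xs" for xs
    using that fin by (metis P_def copy_def card_mono distinct_card)
  moreover obtain xs0 where "P xs0"
    using exists_catalogue_copy[OF assms] by (auto simp: P_def)
  ultimately obtain xs where xs: "P xs" and longest: "\<And>ys. P ys \<Longrightarrow> length ys \<le> length xs"
    using ex_has_greatest_nat[of P xs0 length "Suc (card V)"] by (auto simp: less_Suc_eq_le)
  then obtain T where T: "T \<in> set (catalogue (length xs))" "copy E T xs" and sub: "set xs \<subseteq> V"
    by (auto simp: P_def)
  have n: "length T = length xs" "distinct xs" using T(2) by (auto simp: copy_def)
  have "set xs = V"
  proof (rule ccontr)
    assume "set xs \<noteq> V"
    moreover have "set xs \<noteq> {}" using catalogue_wf(3)[OF T(1)] by auto
    ultimately obtain a p b where ear: "a \<in> set xs" "p \<noteq> []" "distinct p" "set p \<subseteq> V - set xs"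
      "successively (\<lambda>x y. {x, y} \<in> E) (a # p)" "{last p, b} \<in> E" "b \<in> set xs \<union> set p"
      "b \<noteq> last p" "b \<noteq> last (a # butlast p)"
      using exists_ear[OF G sub] by blast
    have "card (set (xs @ p)) \<le> card V"
      using sub ear(4) fin by (intro card_mono) auto
    moreover have "distinct (xs @ p)" using n ear by auto
    ultimately have le: "length T + length p \<le> 8"
      using V(2) n distinct_card[of "xs @ p"] by simp
    obtain e ys where e: "e \<in> set (extensions (length T))" "fst e = length p"
      "copy E (extend T e) ys" "set ys = set xs \<union> set p"
      using extension_of_ear[OF T(2) ear(2,3) _ le ear(1,5-9)] ear(4) by blast
    have len: "length (extend T e) = length T + length p"
      using e(2) by (cases e) (simp add: extend_def)
    \<comment> \<open>The extended graph itself may be missing from the catalogue; it is replaced by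
      a catalogue graph on the same vertices.\<close>
    have "some_embeds (catalogue (length T + length p)) (neighbours (extend T e))"
      using catalogue_extend[of T "length T" e] T(1) n e(1,2) by simp
    then obtain T' zs where "T' \<in> set (catalogue (length T + length p))" "copy E T' zs"
      "set zs = set ys"
      using some_embeds_sound[OF _ e(3)] catalogue_wf(1,2) len by metis
    moreover from this have "length zs = length T + length p"
      using catalogue_wf(2) by (metis copy_def)
    ultimately have "P zs"
      using e(4) sub ear(4) by (auto simp: P_def)
    then show False
      using longest \<open>length zs = _\<close> n ear(2) by fastforce
  qed
  then show ?thesis using T n distinct_card by metis
qed

section \<open>The exceptional graphs\<close>

text \<open>The isomorphism is the inverse of \<open>(!) xs\<close>; \<open>only\<close> says that
  the copy misses no edge of \<open>E\<close>.\<close>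

lemma copy_isomorphic:
  assumes T: "copy E T xs"
    and only: "\<And>x y. x < length T \<Longrightarrow> y < length T \<Longrightarrow> {xs ! x, xs ! y} \<in> E \<Longrightarrow> adj T x y"
    and F: "\<And>x y. x < length T \<Longrightarrow> y < length T \<Longrightarrow> adj T x y \<longleftrightarrow> {x, y} \<in> F"
  shows "isomorphic_graphs (set xs) E {..<length T} F"
proof -
  have "bij_betw ((!) xs) {..<length T} (set xs)"
    using T by (auto simp: copy_def intro: bij_betw_nth)
  then obtain f where f: "bij_betw f (set xs) {..<length T}" "\<And>x. x \<in> set xs \<Longrightarrow> xs ! f x = x"
    by (metis bij_betw_inv_into bij_betw_inv_into_right)
  have "{u, v} \<in> E \<longleftrightarrow> {f u, f v} \<in> F" if "u \<in> set xs" "v \<in> set xs" for u v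
  proof -
    have "f u < length T" "f v < length T"
      using f(1) that by (auto simp: bij_betw_def)
    then show ?thesis
      using only[of "f u" "f v"] F[of "f u" "f v"] copy_adj[OF T, of "f u" "f v"] f(2) that by auto
  qed
  then show ?thesis using f(1) by (auto simp: isomorphic_graphs_def)
qed

lemma copy_add_edge:
  assumes T: "copy E T xs" and xy: "x < y" "y < length T" "{xs ! x, xs ! y} \<in> E"
  shows "copy E (T[y := x # T ! y]) xs"
proof -
  have "{xs ! y, xs ! x} \<in> E"
    using xy(3) by (simp add: insert_commute)
  moreover have "set (T[y := x # T ! y] ! i) = (if i = y then insert x (set (T ! y)) else set (T ! i))"
    for i
    using xy(2) by (simp add: nth_list_update)
  ultimately show ?thesis
    using T xy(1) by (auto simp: copy_def wf_graph_def split: if_splits)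
qed

text \<open>Without an isomorphism, \<open>E\<close> has an edge outside the copy, and by
  \<open>add\<close> one such edge suffices.\<close>

lemma exceptional_copy:
  assumes G: "simple_graph V E" and T: "copy E T xs" "set xs = V"
    and F: "\<And>x y. x < length T \<Longrightarrow> y < length T \<Longrightarrow> adj T x y \<longleftrightarrow> {x, y} \<in> F"
    and no_iso: "\<not> isomorphic_graphs V E {..<length T} F"
    and add: "\<forall>y\<in>set [0..<length T]. \<forall>x\<in>set [0..<y]. if x \<in> set (T ! y) then True
      else some_embeds Ts (neighbours (T[y := x # T ! y]))"
    and Ts: "\<forall>S\<in>set Ts. wf_graph S \<and> length S = length T"
  shows "\<exists>S\<in>set Ts. \<exists>ys. copy E S ys \<and> set ys = V"
proof -
  obtain x y where xy: "x < length T" "y < length T" "{xs ! x, xs ! y} \<in> E" "\<not> adj T x y"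
    using copy_isomorphic[OF T(1) _ F] no_iso T(2) by blast
  have "x \<noteq> y"
    using xy(3) G by (auto simp: simple_graph_def)
  then obtain x y where xy: "x < y" "y < length T" "{xs ! x, xs ! y} \<in> E" "x \<notin> set (T ! y)"
    using xy by (metis adj_def insert_commute linorder_neqE_nat)
  then have "some_embeds Ts (neighbours (T[y := x # T ! y]))"
    using add by fastforce
  then show ?thesis
    using some_embeds_sound[OF _ copy_add_edge[OF T(1) xy(1-3)]] T(2) Ts by simp
qed

lemma spanning_pc2_copy:
  assumes G: "simple_graph V E" "connected_graph V E" "min_degree V E \<ge> 2"
    and V: "5 \<le> card V" "card V \<le> 8"
    and iso: "\<not> isomorphic_graphs V E G1_verts G1_edges"
      "\<not> isomorphic_graphs V E G2_verts G2_edges"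
  shows "\<exists>T\<in>set (pc2_graphs (card V)). \<exists>xs. copy E T xs \<and> set xs = V"
proof -
  obtain xs T where T: "copy E T xs" "set xs = V" "T \<in> set (catalogue (card V))"
    using spanning_catalogue_copy[OF G] V by auto
  have wf: "\<forall>S\<in>set (pc2_graphs n). wf_graph S \<and> length S = n" for n
    using catalogue_wf(1,2) by (auto simp: catalogue_def)
  consider "T \<in> set (pc2_graphs (card V))" | "card V = 7" "T = G1_graph"
    | "card V = 8" "T = G2_graph"
    using T(3) V by (auto simp: catalogue_def split: if_splits)
  then show ?thesis
  proof cases
    case 1
    then show ?thesis using T by blast
  next
    case 2
    have len: "length T = 7" by (simp add: 2 G1_graph_def)
    have "\<forall>x\<in>set [0..<7]. \<forall>y\<in>set [0..<7]. adj G1_graph x y \<longleftrightarrow> {x, y} \<in> G1_edges"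
      by (simp add: upt_conv_Cons adj_def G1_graph_def G1_edges_def doubleton_eq_iff)
    then have F: "adj T x y \<longleftrightarrow> {x, y} \<in> G1_edges" if "x < 7" "y < 7" for x y
      using that 2 by simp
    have "G1_verts = {..<7}" by (auto simp: G1_verts_def)
    then show ?thesis
      using exceptional_copy[OF G(1) T(1,2), of G1_edges "pc2_graphs 7"] F len G1_add_edge 2 iso(1)
        wf by simp
  next
    case 3
    have len: "length T = 8" by (simp add: 3 G2_graph_def)
    have "\<forall>x\<in>set [0..<8]. \<forall>y\<in>set [0..<8]. adj G2_graph x y \<longleftrightarrow> {x, y} \<in> G2_edges"
      by (simp add: upt_conv_Cons adj_def G2_graph_def G2_edges_def doubleton_eq_iff)
    then have F: "adj T x y \<longleftrightarrow> {x, y} \<in> G2_edges" if "x < 8" "y < 8" for x y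
      using that 3 by simp
    have "G2_verts = {..<8}" by (auto simp: G2_verts_def)
    then show ?thesis
      using exceptional_copy[OF G(1) T(1,2), of G2_edges "pc2_graphs 8"] F len G2_add_edge 3 iso(2)
        wf by simp
  qed
qed

theorem theorem8:
  fixes V :: "'a set" and E :: "'a set set"
  assumes "simple_graph V E"
    and "connected_graph V E"
    and "\<not> complete_graph V E"
    and "5 \<le> card V" and "card V \<le> 8"
    and "\<not> isomorphic_graphs V E G1_verts G1_edges"
    and "\<not> isomorphic_graphs V E G2_verts G2_edges"
    and "min_degree V E \<ge> 2"
  shows "proper_connection_number V E = 2"
proof -
  have "finite V" "E \<subseteq> Pow V"
    using assms(1) by (auto simp: simple_graph_def)
  then have fin: "finite E"
    by (meson finite_Pow_iff finite_subset)
  obtain T xs where T: "T \<in> set (pc2_graphs (card V))" "copy E T xs" "set xs = V"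
    using spanning_pc2_copy assms by blast
  obtain R ps where "proper_coloring T (R, ps)"
    using pc2_graphs_coloring[OF T(1)] by auto
  then obtain c :: "'a set \<Rightarrow> nat" where c: "c ` E \<subseteq> {0, 1}" "proper_connected V E c"
    using proper_coloring_copy[OF _ T(2)] T(3) by blast
  have "card (c ` E) \<le> card {0, 1 :: nat}"
    using c(1) by (intro card_mono) auto
  then have "card (c ` E) = 2"
    using two_colors_needed[OF fin assms(3) c(2)] by simp
  \<comment> \<open>The coloring \<open>c\<close> attains 2, and the lower bound holds for every
    proper connected coloring.\<close>
  then show ?thesis
    unfolding proper_connection_number_def
    using c(2) two_colors_needed[OF fin assms(3)] by (intro Least_equality) auto
qed

end
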